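(* For every integer $n\ge1$, the sixth factorial moment of the area statistic on parking functions of length $n$ is $$\frac{82825}{576576}n^9+\frac{373340075}{110702592}n^8+\frac{9401544029}{332107776}n^7+\frac{14473244813}{127733760}n^6+\frac{414139396709}{1660538880}n^5$$ $$+\frac{88215445651}{332107776}n^4-\frac{18783816473}{332107776}n^3-\frac{643359542029}{1660538880}n^2-\frac{358936540409}{1660538880}n$$ $$+\Big(-\frac{3955}{2048}n^7-\frac{186349}{6144}n^6-\frac{259283273}{1161216}n^5-\frac{119912501}{129024}n^4-\frac{149860633081}{63866880}n^3$$ $$-\frac{601794266581}{166053888}n^2-\frac{864000570107}{276756480}n-\frac{921390308389}{830269440}\Big)E_1(n),$$ and asymptotically, as $n\to\infty$, it equals $\frac{82825}{576576}n^9+O(n^{17/2})$.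
   Context: A parking function of length $n$ is a vector of positive integers $(p_1,\dots,p_n)$, $1\le p_i\le n$, whose non-decreasing rearrangement satisfies $p_{(i)}\le i$ for $1\le i\le n$; there are $(n+1)^{n-1}$ of them. The area statistic is $\mathrm{Area}(p)=\frac{n(n+1)}{2}-\sum_{i=1}^n p_i$. Choose $p$ uniformly at random among parking functions of length $n$; the $k$-th factorial moment of the area is $E[A(A-1)\cdots(A-k+1)]$ with $A=\mathrm{Area}(p)$, and $E_1(n)=E[A]$ is its expectation. *)

theory Defs
  imports "HOL-Probability.Probability" "HOL-Library.Landau_Symbols"
begin

text \<open>The list index is 0-based, so the \<open>(i+1)\<close>-st entry of the non-decreasing
  rearrangement is \<open>sort p ! i\<close>.\<close>

definition parking_functions :: "nat \<Rightarrow> nat list set" where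
  "parking_functions n =
     {p. length p = n \<and> (\<forall>x\<in>set p. 1 \<le> x \<and> x \<le> n) \<and> (\<forall>i<n. sort p ! i \<le> i + 1)}"

definition area :: "nat list \<Rightarrow> real" where
  "area p = real (length p) * (real (length p) + 1) / 2 - real (sum_list p)"

text \<open>\<open>pmf_of_set\<close> is the uniform distribution only on finite nonempty sets.\<close>

lemma finite_parking_functions: "finite (parking_functions n)"
  by (rule finite_subset[OF _ finite_lists_length_eq[of "{1..n}" n]])
     (auto simp: parking_functions_def)

lemma parking_functions_nonempty: "parking_functions n \<noteq> {}"
proof -
  have "sort (replicate n (1::nat)) = replicate n 1"
    by (rule sorted_sort_id) (simp add: sorted_replicate)
  then have "replicate n 1 \<in> parking_functions n"
    by (cases "n = 0") (auto simp: parking_functions_def)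
  then show ?thesis by blast
qed

definition parking_pmf :: "nat \<Rightarrow> nat list pmf" where
  "parking_pmf n = pmf_of_set (parking_functions n)"

definition factorial_moment :: "'a pmf \<Rightarrow> ('a \<Rightarrow> real) \<Rightarrow> nat \<Rightarrow> real" where
  "factorial_moment M X k = measure_pmf.expectation M (\<lambda>x. \<Prod>i<k. X x - real i)"

definition E1 :: "nat \<Rightarrow> real" where
  "E1 n = measure_pmf.expectation (parking_pmf n) area"

end

theory Submission
  imports Defs "HOL-Computational_Algebra.Formal_Power_Series" "HOL-Real_Asymp.Real_Asymp"
begin

text \<open>
  Write \<open>P\<^sub>n(q)\<close> for the sum of \<open>q\<close> to the power of the area over all parking functions of
  length \<open>n\<close>. The \<open>k\<close>-th factorial moment of the area is \<open>k!\<close> times the coefficient of \<open>w\<^sup>k\<close> in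
  \<open>P\<^sub>n(1 + w)\<close>, divided by \<open>P\<^sub>n(1)\<close>. So the exponential generating functions
  \<open>F\<^sub>k = \<Sum>n. x\<^sup>n / n! * [w\<^sup>k] P\<^sub>n(1 + w)\<close> carry everything.

  The combinatorial input is the identity \<open>area_poly_identity\<close>. Let infinitely many spots be
  available to \<open>n\<close> drivers with arbitrary preferences and let \<open>k + 1\<close> be the first spot that
  stays empty: the \<open>k\<close> drivers who prefer one of the spots up to there form a parking function
  of length \<open>k\<close>, and all others prefer a later spot, without any further restriction. The
  resulting identity is the one that relates connected graphs to all graphs, so that
  \<open>w\<^sup>n P\<^sub>n(1 + w)\<close> counts the connected graphs on \<open>n + 1\<close> labelled vertices by edges. In other
  words, with \<open>\<theta> = x d/dx\<close> and \<open>G = \<Sum>n. q^(n choose 2) * x\<^sup>n / n!\<close>, the series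
  \<open>H = \<theta> G / G\<close> has the coefficients \<open>w\<^sup>n P\<^sub>n(1 + w) / n!\<close> at \<open>x^(n + 1)\<close>.

  The series \<open>G\<close> obeys the linear equation \<open>2 q \<partial>G/\<partial>q = \<theta>\<^sup>2 G - \<theta> G\<close>, hence its
  logarithmic derivative obeys \<open>2 q \<partial>H/\<partial>q = \<theta>(\<theta> H + H\<^sup>2 - H)\<close>. Reading off the powers
  of \<open>w\<close> gives a recursion of Wright's type: \<open>F\<^sub>k\<^sub>+\<^sub>1\<close> solves a linear differential equation of first
  order whose inhomogeneity is made of \<open>F\<^sub>0, \<dots>, F\<^sub>k\<close> (\<open>area_moment_egf_equation\<close>), and this
  equation has only one solution in power series.

  The equation for \<open>k = 0\<close> says that \<open>T = x F\<^sub>0\<close> is the tree function. Put \<open>V = 1 / (1 - T)\<close>; then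
  \<open>\<theta> F\<^sub>0 = F\<^sub>0 (V - 1)\<close> and \<open>\<theta> V = V\<^sup>3 - V\<^sup>2\<close>, so \<open>\<theta>\<close> maps the series \<open>F\<^sub>0 p(V)\<close> with polynomial
  \<open>p\<close> to series of this form, and acts on \<open>p\<close> as an explicit operator \<open>L\<close> (\<open>theta_poly\<close>).
  All \<open>F\<^sub>k\<close> with \<open>k \<le> 6\<close> turn out to have this form, \<open>F\<^sub>k = F\<^sub>0 p\<^sub>k(V)\<close>
  (\<open>area_moment_egf_poly\<close>). Since \<open>\<theta>\<close> multiplies the \<open>n\<close>-th coefficient by \<open>n\<close>, a
  formula \<open>a(n) + b(n) E\<^sub>1(n)\<close> for the \<open>k\<close>-th factorial moment, with polynomials \<open>a\<close> and \<open>b\<close>, follows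
  from the polynomial identity \<open>k! p\<^sub>k = a(L) 1 + b(L) p\<^sub>1\<close>, which for \<open>k = 6\<close> is a finite computation.

  For the asymptotics it suffices that \<open>E\<^sub>1(n) = O(n^(3/2))\<close>. In the formula of the same kind for the
  second factorial moment, \<open>E\<^sub>1\<close> enters with a negative sign next to a cubic polynomial. Since \<open>E\<^sub>1\<^sup>2\<close>
  is at most the second moment, it is at most a constant times \<open>n\<^sup>3\<close>.
\<close>

unbundle no vec_syntax
unbundle fps_syntax

section \<open>Decomposition of words at the first empty parking spot\<close>

lemma sorted_nth_le_iff:
  fixes zs :: "'a::linorder list"
  assumes "sorted zs" "i < length zs"
  shows "zs ! i \<le> c \<longleftrightarrow> i < length (filter (\<lambda>x. x \<le> c) zs)"
  using assms
proof (induction zs arbitrary: i)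
  case (Cons z zs)
  show ?case
  proof (cases "z \<le> c")
    case True
    then show ?thesis using Cons by (cases i) auto
  next
    case False
    then have "filter (\<lambda>x. x \<le> c) (z # zs) = []" using Cons.prems(1) by (auto simp: filter_empty_conv)
    moreover have "z \<le> (z # zs) ! i" using Cons.prems
      by (cases i) auto
    ultimately show ?thesis using False by simp
  qed
qed simp

text \<open>Counts are easier to carry through a cut of the word at a given value than the sorted word is.\<close>

lemma parking_functions_count_iff:
  "p \<in> parking_functions n \<longleftrightarrow>
     length p = n \<and> (\<forall>x\<in>set p. 1 \<le> x) \<and> (\<forall>j\<le>n. j \<le> length (filter (\<lambda>x. x \<le> j) p))"
proof -
  have *: "sort p ! i \<le> i + 1 \<longleftrightarrow> Suc i \<le> length (filter (\<lambda>x. x \<le> Suc i) p)" if "i < length p" for i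
    using sorted_nth_le_iff[of "sort p" i "Suc i"] that by (simp add: filter_sort Suc_le_eq)
  have **: "(\<forall>i<n. Suc i \<le> f (Suc i)) \<longleftrightarrow> (\<forall>j\<le>n. j \<le> f j)" for f :: "nat \<Rightarrow> nat"
    by (metis Suc_le_eq not0_implies_Suc le0)
  have "\<forall>x\<in>set p. x \<le> n" if "length p = n" "\<forall>j\<le>n. j \<le> length (filter (\<lambda>x. x \<le> j) p)"
  proof -
    have "length (filter (\<lambda>x. x \<le> n) p) = length p"
      using that by (intro antisym) auto
    then show ?thesis by (metis length_filter_less linorder_neq_iff)
  qed
  moreover have "(\<forall>i<n. sort p ! i \<le> i + 1) \<longleftrightarrow> (\<forall>j\<le>n. j \<le> length (filter (\<lambda>x. x \<le> j) p))" if "length p = n"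
    using * **[of "\<lambda>j. length (filter (\<lambda>x. x \<le> j) p)"] that by simp
  ultimately show ?thesis unfolding parking_functions_def by blast
qed

lemma filter_parking_iff:
  assumes "\<forall>x\<in>set f. 1 \<le> x"
  shows "filter (\<lambda>x. x \<le> k + 1) f \<in> parking_functions k \<longleftrightarrow>
     length (filter (\<lambda>x. x \<le> k + 1) f) = k \<and> (\<forall>j\<le>k. j \<le> length (filter (\<lambda>x. x \<le> j) f))"
proof -
  have "filter (\<lambda>x. x \<le> j) (filter (\<lambda>x. x \<le> k + 1) f) = filter (\<lambda>x. x \<le> j) f" if "j \<le> k" for j
    using that by (auto intro!: filter_cong)
  then show ?thesis using assms by (auto simp: parking_functions_count_iff)
qed

text \<open>The number \<open>k + 1\<close> is the first spot that stays empty. It is the least \<open>k + 1\<close> such that at most \<open>k\<close>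
  drivers prefer one of the spots \<open>1, \<dots>, k + 1\<close>; minimality provides the lower bounds on
  the counts for all earlier spots, and these bounds exclude any second candidate.\<close>

lemma ex1_parking_prefix:
  assumes "\<forall>x\<in>set f. (1::nat) \<le> x"
  shows "\<exists>!k. k \<le> length f \<and> filter (\<lambda>x. x \<le> k + 1) f \<in> parking_functions k"
proof -
  define N where "N = (\<lambda>j. length (filter (\<lambda>x. x \<le> j) f))"
  have mono: "N i \<le> N j" if "i \<le> j" for i j
  proof -
    have "filter (\<lambda>x. x \<le> i) f = filter (\<lambda>x. x \<le> i) (filter (\<lambda>x. x \<le> j) f)"
      using that by (auto intro!: filter_cong)
    then show ?thesis unfolding N_def by (metis length_filter_le)
  qed
  have iff: "filter (\<lambda>x. x \<le> k + 1) f \<in> parking_functions k \<longleftrightarrow> N (k + 1) = k \<and> (\<forall>j\<le>k. j \<le> N j)" for k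
    unfolding N_def by (rule filter_parking_iff[OF assms])
  have ex: "N (length f + 1) \<le> length f" unfolding N_def by (rule length_filter_le)
  define k where "k = (LEAST k. N (k + 1) \<le> k)"
  have k: "N (k + 1) \<le> k" unfolding k_def by (rule LeastI[of "\<lambda>k. N (k+1) \<le> k"]) (rule ex)
  have least: "j < N (j + 1)" if "j < k" for j
    using not_less_Least that unfolding k_def by (metis not_le)
  have le: "\<forall>j\<le>k. j \<le> N j"
  proof (intro allI impI)
    fix j assume "j \<le> k"
    then show "j \<le> N j" using least[of "j - 1"] by (cases j) auto
  qed
  have "N (k + 1) = k" using k le mono[of k "k + 1"] by (meson le_add1 le_antisym le_trans order_refl)
  moreover have "k \<le> length f" unfolding k_def by (rule Least_le) (rule ex)
  moreover have "k' = k" if "N (k' + 1) = k'" "\<forall>j\<le>k'. j \<le> N j" for k'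
  proof (rule linorder_cases[of k k'])
    assume "k < k'"
    then have "k + 1 \<le> N (k + 1)" using that(2) by auto
    then show ?thesis using k by simp
  next
    assume "k' < k"
    then show ?thesis using least[of k'] that(1) by simp
  qed simp
  ultimately show ?thesis unfolding iff using le by blast
qed

abbreviation words :: "'a set \<Rightarrow> nat \<Rightarrow> 'a list set" where
  "words A n \<equiv> {xs. set xs \<subseteq> A \<and> length xs = n}"

lemma sum_words_Suc:
  fixes \<phi> :: "'a list \<Rightarrow> 'b::comm_monoid_add"
  shows "sum \<phi> (words A (Suc n)) = (\<Sum>x\<in>A. \<Sum>xs\<in>words A n. \<phi> (x # xs))"
proof -
  have "inj_on (\<lambda>(xs, x). x # xs) (words A n \<times> A)" by (auto simp: inj_on_def)
  then have "sum \<phi> (words A (Suc n)) = (\<Sum>(xs, x)\<in>words A n \<times> A. \<phi> (x # xs))"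
    by (simp add: lists_length_Suc_eq sum.reindex case_prod_unfold)
  also have "\<dots> = (\<Sum>xs\<in>words A n. \<Sum>x\<in>A. \<phi> (x # xs))"
    by (simp add: sum.cartesian_product)
  finally show ?thesis by (simp add: sum.swap[of _ A])
qed

lemma words_0: "words A 0 = {[]}" by auto

lemma sum_words_prod:
  fixes h :: "'a \<Rightarrow> 'b::comm_semiring_1"
  shows "(\<Sum>xs\<in>words A n. \<Prod>x\<leftarrow>xs. h x) = (\<Sum>x\<in>A. h x) ^ n"
proof (induction n)
  case 0 then show ?case unfolding words_0 by simp
next
  case (Suc n)
  then show ?case
    by (simp only: sum_words_Suc list.map prod_list.Cons sum_distrib_left[symmetric] power_Suc sum_distrib_right)
qed

text \<open>A word over a disjoint union is a choice of the positions of the letters from \<open>A\<close>, a word over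
  \<open>A\<close> and a word over \<open>B\<close>. Keeping \<open>\<phi>\<close> arbitrary in an induction on the length replaces an
  explicit bijection: removing a first letter \<open>x\<close> from \<open>A\<close> only changes \<open>\<phi>\<close> to \<open>\<lambda>ys. \<phi> (x # ys)\<close>,
  and the two kinds of first letters match the two terms of Pascal's rule.\<close>

lemma sum_words_split:
  fixes \<phi> :: "'a list \<Rightarrow> 'b::comm_semiring_1"
  assumes "finite A" "finite B" "A \<inter> B = {}"
  shows "(\<Sum>xs\<in>words (A \<union> B) n. \<phi> (filter (\<lambda>x. x \<in> A) xs) * (\<Prod>x\<leftarrow>filter (\<lambda>x. x \<notin> A) xs. h x))
       = (\<Sum>k\<le>n. of_nat (n choose k) * sum \<phi> (words A k) * sum h B ^ (n - k))"
proof (induction n arbitrary: \<phi>)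
  case 0
  show ?case by (simp add: words_0 del: length_0_conv)
next
  case (Suc n)
  let ?\<beta> = "sum h B"
  let ?W = "\<lambda>\<phi> n. \<Sum>xs\<in>words (A \<union> B) n. \<phi> (filter (\<lambda>x. x \<in> A) xs) * (\<Prod>x\<leftarrow>filter (\<lambda>x. x \<notin> A) xs. h x)"
  let ?T = "\<lambda>k. sum \<phi> (words A k)"
  have "?W \<phi> (Suc n) = (\<Sum>x\<in>A \<union> B. \<Sum>xs\<in>words (A \<union> B) n.
          \<phi> (filter (\<lambda>x. x \<in> A) (x # xs)) * (\<Prod>x\<leftarrow>filter (\<lambda>x. x \<notin> A) (x # xs). h x))"
    by (rule sum_words_Suc)
  also have "\<dots> = (\<Sum>x\<in>A. \<Sum>xs\<in>words (A \<union> B) n.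
          \<phi> (filter (\<lambda>x. x \<in> A) (x # xs)) * (\<Prod>x\<leftarrow>filter (\<lambda>x. x \<notin> A) (x # xs). h x))
        + (\<Sum>x\<in>B. \<Sum>xs\<in>words (A \<union> B) n.
          \<phi> (filter (\<lambda>x. x \<in> A) (x # xs)) * (\<Prod>x\<leftarrow>filter (\<lambda>x. x \<notin> A) (x # xs). h x))"
    using assms by (rule sum.union_disjoint)
  also have "\<dots> = (\<Sum>x\<in>A. ?W (\<lambda>ys. \<phi> (x # ys)) n) + (\<Sum>x\<in>B. h x * ?W \<phi> n)"
  proof (intro arg_cong2[of _ _ _ _ "(+)"] sum.cong refl)
    fix x assume "x \<in> B"
    then have "x \<notin> A" using assms by auto
    then show "(\<Sum>xs\<in>words (A \<union> B) n.
          \<phi> (filter (\<lambda>x. x \<in> A) (x # xs)) * (\<Prod>x\<leftarrow>filter (\<lambda>x. x \<notin> A) (x # xs). h x)) = h x * ?W \<phi> n"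
      by (simp add: sum_distrib_left mult_ac)
  qed simp
  also have "(\<Sum>x\<in>B. h x * ?W \<phi> n) = ?\<beta> * ?W \<phi> n" by (simp add: sum_distrib_right)
  also have "(\<Sum>x\<in>A. ?W (\<lambda>ys. \<phi> (x # ys)) n)
      = (\<Sum>x\<in>A. \<Sum>k\<le>n. of_nat (n choose k) * (\<Sum>ys\<in>words A k. \<phi> (x # ys)) * ?\<beta> ^ (n - k))"
    by (intro sum.cong refl Suc.IH)
  also have "\<dots> = (\<Sum>k\<le>n. of_nat (n choose k) * ?T (Suc k) * ?\<beta> ^ (n - k))"
    by (subst sum.swap) (simp add: sum_words_Suc sum_distrib_left sum_distrib_right del: length_Suc_conv)
  also have "?W \<phi> n = (\<Sum>k\<le>n. of_nat (n choose k) * ?T k * ?\<beta> ^ (n - k))" by (rule Suc.IH)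
  also have "?\<beta> * \<dots> = (\<Sum>k\<le>n. of_nat (n choose k) * ?T k * ?\<beta> ^ (Suc n - k))"
    by (subst sum_distrib_left, intro sum.cong refl) (simp add: Suc_diff_le mult_ac)
  also have "\<dots> = ?T 0 * ?\<beta> ^ Suc n + (\<Sum>k\<le>n. of_nat (n choose Suc k) * ?T (Suc k) * ?\<beta> ^ (n - k))"
  proof -
    have "(\<Sum>k\<le>n. of_nat (n choose k) * ?T k * ?\<beta> ^ (Suc n - k))
        = (\<Sum>k\<le>Suc n. of_nat (n choose k) * ?T k * ?\<beta> ^ (Suc n - k))" by (simp add: binomial_eq_0)
    then show ?thesis by (simp only: sum.atMost_Suc_shift) simp
  qed
  also have "(\<Sum>k\<le>n. of_nat (n choose k) * ?T (Suc k) * ?\<beta> ^ (n - k)) + \<dots>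
      = (\<Sum>k\<le>Suc n. of_nat (Suc n choose k) * ?T k * ?\<beta> ^ (Suc n - k))"
    by (simp only: sum.atMost_Suc_shift)
       (simp add: sum.distrib[symmetric] algebra_simps)
  finally show ?case .
qed

text \<open>The area as a natural number, which can serve as an exponent.\<close>

definition nat_area :: "nat list \<Rightarrow> nat" where
  "nat_area p = (Suc (length p) choose 2) - sum_list p"

lemma sum_list_parking_le:
  assumes "p \<in> parking_functions n"
  shows "sum_list p \<le> Suc n choose 2"
proof -
  have "sum_list p = sum_list (sort p)" by (metis mset_sort sum_mset_sum_list)
  also have "\<dots> = (\<Sum>i<n. sort p ! i)"
    using assms by (simp add: sum_list_sum_nth parking_functions_def atLeast0LessThan)
  also have "\<dots> \<le> (\<Sum>i<n. i + 1)" using assms by (intro sum_mono) (auto simp: parking_functions_def)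
  also have "\<dots> = Suc n choose 2"
    by (induction n) (simp_all add: choose_two)
  finally show ?thesis .
qed

lemma nat_area_add:
  "p \<in> parking_functions n \<Longrightarrow> nat_area p + sum_list p = Suc n choose 2"
  using sum_list_parking_le[of p n] by (simp add: nat_area_def parking_functions_def)

lemma area_eq_nat_area: "p \<in> parking_functions n \<Longrightarrow> area p = real (nat_area p)"
proof -
  assume p: "p \<in> parking_functions n"
  have "2 * (Suc n choose 2) = n * (n + 1)" by (simp add: choose_two)
  then have "2 * real (Suc n choose 2) = real n * (real n + 1)"
    by (metis of_nat_1 of_nat_add of_nat_mult of_nat_numeral)
  moreover have "real (Suc n choose 2) = real (nat_area p) + real (sum_list p)"
    using nat_area_add[OF p] by (metis of_nat_add)
  moreover have "length p = n" using p by (simp add: parking_functions_def)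
  ultimately show ?thesis by (simp add: area_def)
qed

text \<open>Each word over \<open>{1..M}\<close> is counted once, at its first empty spot \<open>k + 1\<close>; the bound \<open>n < M\<close>
  guarantees that this spot lies on the street.\<close>

lemma sum_words_parking:
  fixes t :: real
  assumes "n < M"
  shows "(\<Sum>x=1..M. t ^ x) ^ n =
    (\<Sum>k\<le>n. of_nat (n choose k) * (\<Sum>p\<in>parking_functions k. t ^ sum_list p)
            * (\<Sum>x=k + 2..M. t ^ x) ^ (n - k))"
proof -
  have pw: "(\<Prod>x\<leftarrow>xs. t ^ x) = t ^ sum_list xs" for xs :: "nat list"
    by (induction xs) (simp_all add: power_add)
  define \<phi> where "\<phi> = (\<lambda>k ys. if ys \<in> parking_functions k then t ^ sum_list ys else 0)"
  let ?W = "words {1..M} n"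
  have pos: "\<forall>x\<in>set xs. 1 \<le> x" and len: "length xs = n" if "xs \<in> ?W" for xs
    using that by auto
  have "(\<Sum>x=1..M. t ^ x) ^ n = (\<Sum>xs\<in>?W. t ^ sum_list xs)"
    using sum_words_prod[of "\<lambda>x. t ^ x" "{1..M}" n] by (simp add: pw)
  also have "\<dots> = (\<Sum>xs\<in>?W. \<Sum>k\<le>n. \<phi> k (filter (\<lambda>x. x \<le> k + 1) xs) * t ^ sum_list (filter (\<lambda>x. \<not> x \<le> k + 1) xs))"
  proof (rule sum.cong[OF refl])
    fix xs assume xs: "xs \<in> ?W"
    obtain k where k: "k \<le> n" "filter (\<lambda>x. x \<le> k + 1) xs \<in> parking_functions k"
      and uniq: "\<And>k'. k' \<le> n \<Longrightarrow> filter (\<lambda>x. x \<le> k' + 1) xs \<in> parking_functions k' \<Longrightarrow> k' = k"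
      using ex1_parking_prefix[OF pos[OF xs]] unfolding len[OF xs] Ex1_def by blast
    have "sum_list xs = sum_list (filter (\<lambda>x. x \<le> k + 1) xs) + sum_list (filter (\<lambda>x. \<not> x \<le> k + 1) xs)"
      by (induction xs) auto
    then have "t ^ sum_list xs = \<phi> k (filter (\<lambda>x. x \<le> k + 1) xs) * t ^ sum_list (filter (\<lambda>x. \<not> x \<le> k + 1) xs)"
      using k by (simp add: \<phi>_def power_add)
    also have "\<dots> = (\<Sum>k'\<le>n. if k' = k then \<phi> k (filter (\<lambda>x. x \<le> k + 1) xs) * t ^ sum_list (filter (\<lambda>x. \<not> x \<le> k + 1) xs) else 0)"
      using k by simp
    also have "\<dots> = (\<Sum>k'\<le>n. \<phi> k' (filter (\<lambda>x. x \<le> k' + 1) xs) * t ^ sum_list (filter (\<lambda>x. \<not> x \<le> k' + 1) xs))"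
    proof (rule sum.cong[OF refl])
      fix k' assume "k' \<in> {..n}"
      then have "\<phi> k' (filter (\<lambda>x. x \<le> k' + 1) xs) = 0" if "k' \<noteq> k"
        unfolding \<phi>_def using uniq[of k'] that by (simp only: atMost_iff if_False) metis
      then show "(if k' = k then \<phi> k (filter (\<lambda>x. x \<le> k + 1) xs) * t ^ sum_list (filter (\<lambda>x. \<not> x \<le> k + 1) xs) else 0)
        = \<phi> k' (filter (\<lambda>x. x \<le> k' + 1) xs) * t ^ sum_list (filter (\<lambda>x. \<not> x \<le> k' + 1) xs)"
        by (cases "k' = k") simp_all
    qed
    finally show "t ^ sum_list xs = \<dots>" .
  qed
  also have "\<dots> = (\<Sum>k\<le>n. \<Sum>xs\<in>?W. \<phi> k (filter (\<lambda>x. x \<le> k + 1) xs) * t ^ sum_list (filter (\<lambda>x. \<not> x \<le> k + 1) xs))"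
    by (rule sum.swap)
  also have "\<dots> = (\<Sum>k\<le>n. of_nat (n choose k) * (\<Sum>p\<in>parking_functions k. t ^ sum_list p)
            * (\<Sum>x=k + 2..M. t ^ x) ^ (n - k))"
  proof (rule sum.cong[OF refl])
    fix k assume "k \<in> {..n}"
    then have k: "k \<le> n" by simp
    have un: "{1..k + 1} \<union> {k + 2..M} = {1..M}" using k assms by auto
    have "(\<Sum>xs\<in>?W. \<phi> k (filter (\<lambda>x. x \<le> k + 1) xs) * t ^ sum_list (filter (\<lambda>x. \<not> x \<le> k + 1) xs))
        = (\<Sum>xs\<in>words ({1..k + 1} \<union> {k + 2..M}) n. \<phi> k (filter (\<lambda>x. x \<in> {1..k + 1}) xs)
             * (\<Prod>x\<leftarrow>filter (\<lambda>x. x \<notin> {1..k + 1}) xs. t ^ x))"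
      unfolding un
    proof (rule sum.cong[OF refl])
      fix xs assume xs: "xs \<in> ?W"
      have "filter (\<lambda>x. x \<le> k + 1) xs = filter (\<lambda>x. x \<in> {1..k + 1}) xs"
        "filter (\<lambda>x. \<not> x \<le> k + 1) xs = filter (\<lambda>x. x \<notin> {1..k + 1}) xs"
        using pos[OF xs] by (auto intro!: filter_cong)
      then show "\<phi> k (filter (\<lambda>x. x \<le> k + 1) xs) * t ^ sum_list (filter (\<lambda>x. \<not> x \<le> k + 1) xs)
        = \<phi> k (filter (\<lambda>x. x \<in> {1..k + 1}) xs) * (\<Prod>x\<leftarrow>filter (\<lambda>x. x \<notin> {1..k + 1}) xs. t ^ x)"
        unfolding pw by (simp only:)
    qed
    also have "\<dots> = (\<Sum>j\<le>n. of_nat (n choose j) * sum (\<phi> k) (words {1..k + 1} j) * (\<Sum>x=k + 2..M. t ^ x) ^ (n - j))"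
      by (rule sum_words_split) auto
    also have "\<dots> = (\<Sum>j\<le>n. if j = k then of_nat (n choose k) * (\<Sum>p\<in>parking_functions k. t ^ sum_list p)
            * (\<Sum>x=k + 2..M. t ^ x) ^ (n - k) else 0)"
    proof (rule sum.cong[OF refl])
      fix j assume "j \<in> {..n}"
      have "finite (words {1..k + 1} j)" by (rule finite_lists_length_eq) simp
      then have "sum (\<phi> k) (words {1..k + 1} j) = (\<Sum>p\<in>words {1..k + 1} j \<inter> parking_functions k. t ^ sum_list p)"
        unfolding \<phi>_def by (simp add: sum.inter_restrict)
      also have "words {1..k + 1} j \<inter> parking_functions k = (if j = k then parking_functions k else {})"
        unfolding parking_functions_def by force
      finally show "of_nat (n choose j) * sum (\<phi> k) (words {1..k + 1} j) * (\<Sum>x=k + 2..M. t ^ x) ^ (n - j)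
         = (if j = k then of_nat (n choose k) * (\<Sum>p\<in>parking_functions k. t ^ sum_list p)
            * (\<Sum>x=k + 2..M. t ^ x) ^ (n - k) else 0)" by auto
    qed
    also have "\<dots> = of_nat (n choose k) * (\<Sum>p\<in>parking_functions k. t ^ sum_list p)
            * (\<Sum>x=k + 2..M. t ^ x) ^ (n - k)" using k by simp
    finally show "(\<Sum>xs\<in>?W. \<phi> k (filter (\<lambda>x. x \<le> k + 1) xs) * t ^ sum_list (filter (\<lambda>x. \<not> x \<le> k + 1) xs)) = \<dots>" .
  qed
  finally show ?thesis .
qed

text \<open>The street becomes infinite: \<open>M\<close> tends to infinity.\<close>

lemma parking_sum_identity:
  fixes t :: real
  assumes "0 < t" "t < 1"
  shows "(t / (1 - t)) ^ n = (\<Sum>k\<le>n. of_nat (n choose k) * (\<Sum>p\<in>parking_functions k. t ^ sum_list p)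
            * (t ^ (k + 2) / (1 - t)) ^ (n - k))"
proof (rule LIMSEQ_unique)
  have lim: "(\<lambda>M. \<Sum>x=a..M. t ^ x) \<longlonglongrightarrow> t ^ a / (1 - t)" for a
  proof -
    have "(\<lambda>M. (t ^ a - t ^ Suc M) / (1 - t)) \<longlonglongrightarrow> (t ^ a - 0) / (1 - t)"
      using assms by (intro tendsto_intros LIMSEQ_Suc LIMSEQ_power_zero) auto
    moreover have "\<forall>\<^sub>F M in sequentially. (t ^ a - t ^ Suc M) / (1 - t) = (\<Sum>x=a..M. t ^ x)"
      using eventually_ge_at_top[of a] by eventually_elim (use assms in \<open>simp add: sum_gp\<close>)
    ultimately show ?thesis using tendsto_cong by fastforce
  qed
  show "(\<lambda>M. (\<Sum>x=1..M. t ^ x) ^ n) \<longlonglongrightarrow> (t / (1 - t)) ^ n"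
    using tendsto_power[OF lim[of 1], of n] by simp
  have "(\<lambda>M. \<Sum>k\<le>n. of_nat (n choose k) * (\<Sum>p\<in>parking_functions k. t ^ sum_list p)
            * (\<Sum>x=k + 2..M. t ^ x) ^ (n - k)) \<longlonglongrightarrow>
     (\<Sum>k\<le>n. of_nat (n choose k) * (\<Sum>p\<in>parking_functions k. t ^ sum_list p)
            * (t ^ (k + 2) / (1 - t)) ^ (n - k))"
    by (intro tendsto_intros lim)
  moreover have "\<forall>\<^sub>F M in sequentially. (\<Sum>k\<le>n. of_nat (n choose k) * (\<Sum>p\<in>parking_functions k. t ^ sum_list p)
            * (\<Sum>x=k + 2..M. t ^ x) ^ (n - k)) = (\<Sum>x=1..M. t ^ x) ^ n"
    using eventually_gt_at_top[of n] by eventually_elim (simp only: sum_words_parking)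
  ultimately show "(\<lambda>M. (\<Sum>x=1..M. t ^ x) ^ n) \<longlonglongrightarrow>
     (\<Sum>k\<le>n. of_nat (n choose k) * (\<Sum>p\<in>parking_functions k. t ^ sum_list p)
            * (t ^ (k + 2) / (1 - t)) ^ (n - k))"
    by (rule Lim_transform_eventually)
qed

definition area_poly :: "nat \<Rightarrow> real poly" where
  "area_poly n = (\<Sum>p\<in>parking_functions n. [:1, 1:] ^ nat_area p)"

lemma choose_two_add:
  "(a + b) choose 2 = (a choose 2) + (b choose 2) + a * b"
  by (induction b) (simp_all add: numeral_2_eq_2)

text \<open>The substitution \<open>t = 1 / q\<close> turns the sum of the entries into the area. The exponents of \<open>q\<close> combine
  by \<open>choose_two_add\<close> with \<open>n + 1 = (k + 1) + (n - k)\<close>. The polynomial variable is \<open>w = q - 1\<close>, so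
  \<open>[:1, 1:]\<close> is \<open>q\<close>; the polynomials agree because they agree at all \<open>w > 0\<close>.\<close>

lemma area_poly_identity:
  "(\<Sum>k\<le>n. of_nat (n choose k) * [:0, 1:] ^ k * area_poly k * [:1, 1:] ^ ((n - k) choose 2))
     = [:1, 1:] ^ (Suc n choose 2)" (is "?l = ?r")
proof -
  have "poly ?l w = poly ?r w" if "w > 0" for w :: real
  proof -
    define q where "q = 1 + w"
    define t where "t = 1 / q"
    have t: "0 < t" "t < 1" and q: "q > 0" and tq: "t * q = 1" and w: "w * t = 1 - t"
      using that by (auto simp: t_def q_def field_simps)
    have ap: "poly (area_poly k) w = q ^ (Suc k choose 2) * (\<Sum>p\<in>parking_functions k. t ^ sum_list p)" for k
    proof -
      have "q ^ nat_area p = q ^ (Suc k choose 2) * t ^ sum_list p" if "p \<in> parking_functions k" for p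
      proof -
        have "q ^ (Suc k choose 2) * t ^ sum_list p = q ^ nat_area p * (t * q) ^ sum_list p"
          unfolding nat_area_add[OF that, symmetric] by (simp add: power_add power_mult_distrib)
        then show ?thesis by (simp add: tq)
      qed
      then show ?thesis
        by (simp add: area_poly_def poly_sum sum_distrib_left q_def)
    qed
    have "q ^ (Suc n choose 2) = q ^ (Suc n choose 2) * ((1 - t) / t) ^ n * (t / (1 - t)) ^ n"
      using t by (simp add: power_mult_distrib[symmetric] mult.assoc)
    also have "\<dots> = (\<Sum>k\<le>n. of_nat (n choose k) * w ^ k * poly (area_poly k) w * q ^ ((n - k) choose 2))"
    proof (subst parking_sum_identity[OF t], subst sum_distrib_left, rule sum.cong[OF refl])
      fix k assume "k \<in> {..n}"
      then have n: "n = k + (n - k)" by simp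
      define m where "m = n - k"
      have n: "n = k + m" using n by (simp add: m_def)
      have wt: "w = (1 - t) / t" using w t by (simp add: field_simps)
      have 1: "((1 - t) / t) ^ n * (t ^ (k + 2) / (1 - t)) ^ m = w ^ k * (t ^ (k + 1)) ^ m"
        using t unfolding n wt power_add power_mult_distrib power_divide by (simp add: field_simps power2_eq_square power_mult_distrib)
      have "Suc n choose 2 = (Suc k choose 2) + (m choose 2) + (k + 1) * m"
        using choose_two_add[of "Suc k" m] by (simp add: n)
      then have 2: "q ^ (Suc n choose 2) = q ^ (Suc k choose 2) * q ^ (m choose 2) * (q ^ (k + 1)) ^ m"
        by (simp only: power_add power_mult)
      have 3: "(q ^ (k + 1)) ^ m * (t ^ (k + 1)) ^ m = 1"
        unfolding power_mult_distrib[symmetric] using tq by (simp add: mult.commute)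
      define S where "S = (\<Sum>p\<in>parking_functions k. t ^ sum_list p)"
      have "q ^ (Suc n choose 2) * ((1 - t) / t) ^ n * (of_nat (n choose k) * S * (t ^ (k + 2) / (1 - t)) ^ m)
         = of_nat (n choose k) * S * q ^ (Suc n choose 2) * (((1 - t) / t) ^ n * (t ^ (k + 2) / (1 - t)) ^ m)"
        by (simp only: mult_ac)
      also have "\<dots> = of_nat (n choose k) * w ^ k * (q ^ (Suc k choose 2) * S) * q ^ (m choose 2) * ((q ^ (k + 1)) ^ m * (t ^ (k + 1)) ^ m)"
        unfolding 1 2 by (simp only: mult_ac)
      finally show "q ^ (Suc n choose 2) * ((1 - t) / t) ^ n * (of_nat (n choose k) * (\<Sum>p\<in>parking_functions k. t ^ sum_list p)
           * (t ^ (k + 2) / (1 - t)) ^ (n - k)) = of_nat (n choose k) * w ^ k * poly (area_poly k) w * q ^ ((n - k) choose 2)"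
        unfolding 3 unfolding ap S_def m_def by (simp only: mult_1_right)
    qed
    finally show ?thesis by (simp add: poly_sum q_def)
  qed
  then have "{0::real<..} \<subseteq> {w. poly (?l - ?r) w = 0}" by auto
  moreover have "infinite {0::real<..}" by (rule infinite_Ioi)
  ultimately have "infinite {w. poly (?l - ?r) w = 0}" using finite_subset by blast
  then have "?l - ?r = 0" using poly_roots_finite by blast
  then show ?thesis by simp
qed

section \<open>The logarithm of the graph generating function\<close>

text \<open>The operator \<open>\<theta> = x d/dx\<close>.\<close>

definition fps_theta :: "'a::comm_semiring_1 fps \<Rightarrow> 'a fps" where
  "fps_theta f = fps_X * fps_deriv f"

lemma fps_theta_nth [simp]: "fps_theta f $ n = of_nat n * f $ n"
  by (cases n) (simp_all add: fps_theta_def)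

lemma fps_theta_add [simp]: "fps_theta (f + g) = fps_theta f + fps_theta g"
  by (simp add: fps_eq_iff algebra_simps)

lemma fps_theta_diff [simp]: "fps_theta (f - g :: 'a::comm_ring_1 fps) = fps_theta f - fps_theta g"
  by (simp add: fps_eq_iff algebra_simps)

lemma fps_theta_mult [simp]:
  "fps_theta (f * g :: 'a::comm_ring_1 fps) = fps_theta f * g + f * fps_theta g"
  by (simp add: fps_theta_def algebra_simps)

lemma fps_theta_X [simp]: "fps_theta (fps_X :: 'a::comm_ring_1 fps) = fps_X"
  by (simp add: fps_theta_def)

lemma fps_theta_const [simp]: "fps_theta (fps_const c) = 0"
  by (simp add: fps_theta_def)

lemma of_nat_mult_eq_smult: "of_nat n * p = smult (of_nat n) p" for p :: "real poly"
  by (simp add: of_nat_poly)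

lemma pderiv_sum: "pderiv (sum f A) = (\<Sum>x\<in>A. pderiv (f x :: real poly))"
  by (induction A rule: infinite_finite_induct) (simp_all add: pderiv_add)

lemma smult_sum_right: "smult c (sum f A) = (\<Sum>x\<in>A. smult c (f x :: real poly))"
  by (induction A rule: infinite_finite_induct) (simp_all add: smult_add_right)

lemma fps_theta_0 [simp]: "fps_theta 0 = 0" and fps_theta_1 [simp]: "fps_theta 1 = 0"
  by (simp_all add: fps_theta_def)

text \<open>The operator \<open>q \<partial>/\<partial>q\<close> in the coordinate \<open>w = q - 1\<close>, applied to each coefficient.\<close>

definition q_derivative :: "real poly fps \<Rightarrow> real poly fps" where
  "q_derivative f = Abs_fps (\<lambda>n. [:1, 1:] * pderiv (f $ n))"

lemma q_derivative_mult: "q_derivative (f * g) = q_derivative f * g + f * q_derivative g"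
  unfolding fps_eq_iff fps_add_nth fps_mult_nth q_derivative_def fps_nth_Abs_fps
    pderiv_sum pderiv_mult sum_distrib_left sum.distrib[symmetric]
  by (intro allI sum.cong refl) (simp only: ring_distribs mult_ac add_ac)

lemma q_derivative_theta: "q_derivative (fps_theta f) = fps_theta (q_derivative f)"
  unfolding q_derivative_def fps_eq_iff
  by (simp add: pderiv_mult mult.left_commute del: mult_pCons_left mult_pCons_right)

text \<open>All labelled graphs, counted by vertices and weighted by \<open>w\<close> for each edge: an edge is
  absent (\<open>1\<close>) or present (\<open>w\<close>), whence \<open>q = 1 + w\<close> for each pair of vertices.\<close>

definition graph_fps :: "real poly fps" where
  "graph_fps = Abs_fps (\<lambda>n. smult (1 / fact n) ([:1, 1:] ^ (n choose 2)))"

definition area_egf_coeff :: "nat \<Rightarrow> real poly" where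
  "area_egf_coeff n = smult (1 / fact n) (area_poly n)"

definition log_graph_deriv :: "real poly fps" where
  "log_graph_deriv = Abs_fps (\<lambda>n. [:0, 1:] ^ n * area_egf_coeff n)"

lemma graph_fps_neq_0: "graph_fps \<noteq> 0"
proof
  assume "graph_fps = 0"
  then have "graph_fps $ 0 = 0" by simp
  then show False by (simp add: graph_fps_def)
qed

text \<open>This is \<open>area_poly_identity\<close>, divided by \<open>n!\<close>.\<close>

lemma theta_graph_fps: "fps_theta graph_fps = (fps_X * log_graph_deriv) * graph_fps"
proof (rule fps_ext)
  fix n
  show "fps_theta graph_fps $ n = ((fps_X * log_graph_deriv) * graph_fps) $ n"
  proof (cases n)
    case 0
    then show ?thesis by (simp add: mult.assoc)
  next
    case (Suc m)
    have "(log_graph_deriv * graph_fps) $ m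
        = (\<Sum>k\<le>m. smult (1 / fact m) (of_nat (m choose k) * [:0, 1:] ^ k * area_poly k * [:1, 1:] ^ ((m - k) choose 2)))"
      unfolding fps_mult_nth atMost_atLeast0
    proof (rule sum.cong[OF refl])
      fix k assume "k \<in> {0..m}"
      then have "(1 / fact m :: real) * of_nat (m choose k) = (1 / fact k) * (1 / fact (m - k))"
        by (simp add: binomial_fact)
      then show "log_graph_deriv $ k * graph_fps $ (m - k)
        = smult (1 / fact m) (of_nat (m choose k) * [:0, 1:] ^ k * area_poly k * [:1, 1:] ^ ((m - k) choose 2))"
        unfolding log_graph_deriv_def graph_fps_def area_egf_coeff_def of_nat_mult_eq_smult fps_nth_Abs_fps
        by (simp add: mult.assoc mult.commute[of "fact k"] del: mult_pCons_left mult_pCons_right)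
    qed
    also have "\<dots> = smult (1 / fact m) ([:1, 1:] ^ (Suc m choose 2))"
      unfolding area_poly_identity[symmetric] by (simp only: smult_sum_right)
    also have "\<dots> = of_nat (Suc m) * graph_fps $ Suc m"
      by (simp add: graph_fps_def of_nat_poly del: of_nat_Suc)
    finally show ?thesis using Suc by (simp add: mult.assoc del: of_nat_Suc)
  qed
qed

text \<open>Both sides multiply the \<open>n\<close>-th coefficient by \<open>n (n - 1)\<close>.\<close>

lemma q_derivative_graph_fps:
  "q_derivative graph_fps + q_derivative graph_fps = fps_theta (fps_theta graph_fps) - fps_theta graph_fps"
proof (rule fps_ext)
  fix n
  let ?c = "n choose 2"
  have "[:1, 1:] * pderiv ([:1, 1:] ^ ?c) = (of_nat ?c :: real poly) * [:1, 1:] ^ ?c"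
  proof -
    define Q :: "real poly" where "Q = [:1, 1:]"
    have "pderiv Q = 1" by (simp add: Q_def pderiv_pCons)
    then have "Q * pderiv (Q ^ c) = of_nat c * Q ^ c" for c
      by (cases c) (simp_all add: pderiv_power_Suc of_nat_mult_eq_smult del: power_Suc of_nat_Suc, simp)
    then show ?thesis by (simp add: Q_def)
  qed
  moreover have "of_nat n * of_nat n - of_nat n = (of_nat ?c + of_nat ?c :: real poly)"
  proof -
    have "n * n = n + (?c + ?c)" by (induction n) (simp_all add: numeral_2_eq_2)
    then have "(of_nat (n * n) :: real poly) = of_nat (n + (?c + ?c))" by (rule arg_cong)
    then show ?thesis by simp
  qed
  moreover have "(q_derivative graph_fps + q_derivative graph_fps) $ n
      = smult (1 / fact n) ([:1, 1:] * pderiv ([:1, 1:] ^ ?c) + [:1, 1:] * pderiv ([:1, 1:] ^ ?c))"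
    by (simp add: q_derivative_def graph_fps_def pderiv_smult smult_add_right del: mult_pCons_left mult_pCons_right)
  moreover have "(fps_theta (fps_theta graph_fps) - fps_theta graph_fps) $ n
      = smult (1 / fact n) ((of_nat n * of_nat n - of_nat n) * [:1, 1:] ^ ?c)"
    by (simp add: graph_fps_def mult.assoc left_diff_distrib smult_diff_right del: mult_pCons_left mult_pCons_right)
  ultimately show "(q_derivative graph_fps + q_derivative graph_fps) $ n = (fps_theta (fps_theta graph_fps) - fps_theta graph_fps) $ n"
    by (simp only: distrib_right)
qed

text \<open>The linear equation for \<open>G\<close>, rewritten for \<open>H = \<theta> G / G\<close>: since \<open>\<theta>\<^sup>2 G - \<theta> G = K G\<close> with
  \<open>K = \<theta> H + H\<^sup>2 - H\<close>, the two ways of computing the mixed derivative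
  \<open>2 q \<partial>/\<partial>q (\<theta> G) = \<theta> (K G)\<close> give the claim after cancelling \<open>G\<close>.\<close>

lemma log_graph_fps_equation:
  fixes H :: "real poly fps"
  assumes "H = fps_X * log_graph_deriv"
  shows "q_derivative H + q_derivative H = fps_theta (fps_theta H + H * H - H)"
proof -
  let ?G = graph_fps and ?\<theta> = fps_theta and ?\<delta> = q_derivative
  define K where "K = ?\<theta> H + H * H - H"
  have G: "?\<theta> ?G = H * ?G" unfolding assms by (rule theta_graph_fps)
  have "?\<theta> (?\<theta> ?G) = (?\<theta> H + H * H) * ?G" by (simp add: G algebra_simps)
  then have \<delta>G: "?\<delta> ?G + ?\<delta> ?G = K * ?G"
    using q_derivative_graph_fps by (simp add: G K_def algebra_simps)
  have "?\<theta> (K * ?G) = ?\<delta> (H * ?G) + ?\<delta> (H * ?G)"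
    by (simp only: \<delta>G[symmetric] fps_theta_add q_derivative_theta[symmetric] G)
  also have "\<dots> = (?\<delta> H + ?\<delta> H) * ?G + H * (?\<delta> ?G + ?\<delta> ?G)"
    by (simp only: q_derivative_mult) (simp add: algebra_simps)
  finally have "?\<theta> K * ?G = (?\<delta> H + ?\<delta> H) * ?G"
    unfolding \<delta>G by (simp add: G algebra_simps)
  then show ?thesis using graph_fps_neq_0 by (simp add: K_def)
qed

text \<open>The coefficient of \<open>x^(m + 2)\<close> in the equation for \<open>H\<close>. All its terms contain the factor \<open>w\<^sup>m\<close>,
  which is cancelled.\<close>

lemma area_egf_coeff_equation:
  fixes m :: nat
  defines "a \<equiv> area_egf_coeff"
  shows "2 * ([:1, 1:] * (of_nat (Suc m) * a (Suc m) + [:0, 1:] * pderiv (a (Suc m))))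
       = of_nat (m + 2) * (of_nat (Suc m) * [:0, 1:] * a (Suc m) + (\<Sum>i\<le>m. a i * a (m - i)))"
proof -
  define W :: "real poly" where "W = [:0, 1:]"
  let ?U = log_graph_deriv
  define H where "H = fps_X * ?U"
  let ?S = "\<Sum>i\<le>m. a i * a (m - i)"
  have U: "?U $ n = W ^ n * a n" for n by (simp add: log_graph_deriv_def W_def a_def)
  have UU: "(?U * ?U) $ m = W ^ m * ?S"
    unfolding fps_mult_nth sum_distrib_left atMost_atLeast0
    by (intro sum.cong refl) (simp add: U mult_ac flip: power_add)
  have HH: "H * H = fps_X * (fps_X * (?U * ?U))" by (simp add: H_def mult_ac)
  have "(q_derivative H + q_derivative H) $ (m + 2) = fps_theta (fps_theta H + H * H - H) $ (m + 2)"
    using log_graph_fps_equation[OF H_def] by simp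
  moreover have "q_derivative H $ (m + 2) = [:1, 1:] * pderiv (W ^ Suc m * a (Suc m))"
    by (simp add: q_derivative_def H_def U del: power_Suc mult_pCons_left)
  moreover have "pderiv (W ^ Suc m * a (Suc m)) = W ^ m * (of_nat (Suc m) * a (Suc m) + W * pderiv (a (Suc m)))"
    by (simp only: pderiv_mult pderiv_power_Suc) (simp add: W_def pderiv_pCons of_nat_mult_eq_smult algebra_simps del: of_nat_Suc)
  moreover have "fps_theta (fps_theta H + H * H - H) $ (m + 2)
     = of_nat (m + 2) * (W ^ m * (of_nat (Suc m) * W * a (Suc m) + ?S))"
  proof -
    have "H $ (m + 2) = W ^ Suc m * a (Suc m)" by (simp add: H_def U)
    moreover have "(H * H) $ (m + 2) = W ^ m * ?S" by (simp add: HH UU)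
    ultimately show ?thesis
      unfolding fps_theta_nth fps_add_nth fps_sub_nth by (simp add: algebra_simps)
  qed
  ultimately have "[:1, 1:] * (W ^ m * (of_nat (Suc m) * a (Suc m) + W * pderiv (a (Suc m))))
       + [:1, 1:] * (W ^ m * (of_nat (Suc m) * a (Suc m) + W * pderiv (a (Suc m))))
     = of_nat (m + 2) * (W ^ m * (of_nat (Suc m) * W * a (Suc m) + ?S))"
    by (simp only: fps_add_nth)
  moreover have "P * (2 * (Q * Z)) = P * (r * Y)" if "Q * (P * Z) + Q * (P * Z) = r * (P * Y)"
    for P Q Z r Y :: "real poly"
    using that by (simp add: algebra_simps)
  ultimately have "W ^ m * (2 * ([:1, 1:] * (of_nat (Suc m) * a (Suc m) + W * pderiv (a (Suc m)))))
     = W ^ m * (of_nat (m + 2) * (of_nat (Suc m) * W * a (Suc m) + ?S))"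
    by blast
  moreover have "W ^ m \<noteq> 0" by (simp add: W_def)
  ultimately show ?thesis unfolding W_def by (simp only: mult_cancel_left) blast
qed

text \<open>The series \<open>F\<^sub>k\<close>: its \<open>n\<close>-th coefficient is the sum of the binomial coefficients
  \<open>(area choose k)\<close> over the parking functions of length \<open>n\<close>, divided by \<open>n!\<close>.\<close>

definition area_moment_egf :: "nat \<Rightarrow> real fps" where
  "area_moment_egf k = Abs_fps (\<lambda>n. coeff (area_egf_coeff n) k)"

lemma coeff_one_plus_times: "coeff ([:1, 1:] * p) k = coeff p k + (if k = 0 then 0 else coeff p (k - 1))"
  for p :: "'a::comm_semiring_1 poly"
  by (cases k) simp_all

lemma area_moment_egf_nth_0: "area_moment_egf k $ 0 = (if k = 0 then 1 else 0)"
proof -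
  have "parking_functions 0 = {[]}" by (auto simp: parking_functions_def)
  then show ?thesis
    by (simp add: area_moment_egf_def area_egf_coeff_def area_poly_def nat_area_def numeral_2_eq_2)
qed

text \<open>The coefficient of \<open>w\<^sup>k\<close> in \<open>area_egf_coeff_equation\<close>.\<close>

lemma area_moment_coeff_equation:
  fixes m k :: nat
  defines "F \<equiv> area_moment_egf"
  shows "2 * (real (Suc m + k) * F k $ Suc m + (if k = 0 then 0 else real (m + k) * F (k - 1) $ Suc m))
    = real (m + 2) * ((if k = 0 then 0 else real (Suc m) * F (k - 1) $ Suc m) + (\<Sum>i\<le>k. F i * F (k - i)) $ m)"
proof -
  let ?a = "area_egf_coeff"
  have F: "F k $ n = coeff (?a n) k" for k n by (simp add: F_def area_moment_egf_def)
  have nat_mult: "coeff (of_nat n * p) k = real n * coeff p k" for n k and p :: "real poly"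
    by (simp add: of_nat_poly)
  have two_mult: "coeff (2 * p) k = 2 * coeff p k" for k and p :: "real poly"
    using nat_mult[of 2 p k] by simp
  have X_mult: "coeff ([:0, 1:] * p) k = (if k = 0 then 0 else coeff p (k - 1))" for k and p :: "real poly"
    by (cases k) simp_all
  have "coeff (\<Sum>i\<le>m. ?a i * ?a (m - i)) k = (\<Sum>i\<le>m. \<Sum>j\<le>k. F j $ i * F (k - j) $ (m - i))"
    by (simp add: coeff_sum coeff_mult F)
  also have "\<dots> = (\<Sum>i\<le>k. F i * F (k - i)) $ m"
    by (subst sum.swap) (simp add: fps_sum_nth fps_mult_nth atMost_atLeast0)
  finally have S: "coeff (\<Sum>i\<le>m. ?a i * ?a (m - i)) k = (\<Sum>i\<le>k. F i * F (k - i)) $ m" .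
  have D: "coeff ([:0, 1:] * pderiv p) j = real j * coeff p j" for p :: "real poly" and j
    unfolding X_mult by (simp add: coeff_pderiv)
  have "coeff (2 * ([:1, 1:] * (of_nat (Suc m) * ?a (Suc m) + [:0, 1:] * pderiv (?a (Suc m))))) k
     = 2 * (real (Suc m + k) * F k $ Suc m + (if k = 0 then 0 else real (m + k) * F (k - 1) $ Suc m))"
    unfolding two_mult coeff_one_plus_times coeff_add nat_mult D F
    by (cases k) (simp_all add: algebra_simps)
  moreover have "coeff (of_nat (m + 2) * (of_nat (Suc m) * [:0, 1:] * ?a (Suc m) + (\<Sum>i\<le>m. ?a i * ?a (m - i)))) k
    = real (m + 2) * ((if k = 0 then 0 else real (Suc m) * F (k - 1) $ Suc m) + (\<Sum>i\<le>k. F i * F (k - i)) $ m)"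
    unfolding mult.assoc nat_mult coeff_add X_mult S F by simp
  ultimately show ?thesis
    using arg_cong[OF area_egf_coeff_equation[of m], of "\<lambda>p. coeff p k"] by (simp only:)
qed

lemma area_moment_egf_equation_0:
  fixes F :: "nat \<Rightarrow> real fps"
  defines "F \<equiv> area_moment_egf"
  shows "2 * fps_theta (F 0) = fps_theta (fps_X * (F 0 * F 0)) + fps_X * (F 0 * F 0)"
proof (rule fps_ext)
  fix n show "(2 * fps_theta (F 0)) $ n = (fps_theta (fps_X * (F 0 * F 0)) + fps_X * (F 0 * F 0)) $ n"
  proof (cases n)
    case (Suc m)
    show ?thesis using area_moment_coeff_equation[of m 0]
      unfolding F_def[symmetric] mult_2 fps_add_nth fps_theta_nth Suc fps_X_mult_nth
      by (simp add: algebra_simps)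
  next
    case 0
    show ?thesis unfolding mult_2 fps_add_nth fps_theta_nth 0 by simp
  qed
qed

lemma area_moment_egf_equation:
  fixes F :: "nat \<Rightarrow> real fps" and k :: nat
  defines "F \<equiv> area_moment_egf"
  defines "S \<equiv> fps_X * (\<Sum>i\<le>Suc k. F i * F (Suc k - i))"
  shows "2 * fps_theta (F (Suc k)) + of_nat (2 * Suc k) * F (Suc k)
     = fps_theta (fps_theta (F k)) - fps_theta (F k) - of_nat (2 * k) * F k + fps_theta S + S"
proof (rule fps_ext)
  have of_nat_nth: "(of_nat j * f) $ n = real j * f $ n" for j n and f :: "real fps"
    by (simp flip: fps_of_nat)
  fix n
  show "(2 * fps_theta (F (Suc k)) + of_nat (2 * Suc k) * F (Suc k)) $ n
     = (fps_theta (fps_theta (F k)) - fps_theta (F k) - of_nat (2 * k) * F k + fps_theta S + S) $ n"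
  proof (cases n)
    case 0
    then show ?thesis
      unfolding F_def S_def mult_2[of "fps_theta _"] fps_add_nth fps_sub_nth of_nat_nth fps_theta_nth
      by (simp add: area_moment_egf_nth_0)
  next
    case (Suc m)
    show ?thesis using area_moment_coeff_equation[of m "Suc k"]
      unfolding F_def[symmetric] S_def mult_2[of "fps_theta _"] fps_add_nth fps_sub_nth of_nat_nth fps_theta_nth Suc fps_X_mult_nth
      by (simp add: algebra_simps del: sum.atMost_Suc)
  qed
qed

section \<open>Moment generating functions as polynomials in the tree function\<close>

text \<open>Multiplication by \<open>x\<close> on the right makes the equation triangular: it expresses \<open>2 (n + k + 1)\<close>
  times the \<open>n\<close>-th coefficient of \<open>D\<close> through the earlier ones.\<close>

lemma theta_equation_unique:
  fixes D f :: "real fps"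
  assumes "2 * fps_theta D + of_nat (2 * Suc k) * D = fps_theta (fps_X * (f * D)) + fps_X * (f * D) + (fps_theta (fps_X * (f * D)) + fps_X * (f * D))"
  shows "D = 0"
proof (rule fps_ext)
  fix n
  show "D $ n = 0 $ n"
  proof (induction n rule: less_induct)
    case (less n)
    have "(fps_X * (f * D)) $ n = 0"
    proof (cases n)
      case (Suc m)
      then have "D $ (m - i) = 0" for i using less[of "m - i"] by simp
      then show ?thesis unfolding Suc fps_X_mult_nth by (simp add: fps_mult_nth)
    qed simp
    moreover have "(2 * fps_theta D + of_nat (2 * Suc k) * D) $ n = 2 * real n * D $ n + 2 * real (Suc k) * D $ n"
      by (simp only: fps_add_nth fps_of_nat[symmetric] fps_mult_left_const_nth fps_theta_nth fps_numeral_fps_const)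
    ultimately have "2 * real n * D $ n + 2 * real (Suc k) * D $ n = 0"
      using assms by (simp only: fps_add_nth fps_theta_nth)
    then have "(2 * real n + 2 * real (Suc k)) * D $ n = 0" by (simp only: distrib_right)
    moreover have "2 * real n + 2 * real (Suc k) \<noteq> 0" by simp
    ultimately show ?case by simp
  qed
qed

abbreviation parking_egf :: "real fps" where "parking_egf \<equiv> area_moment_egf 0"

text \<open>The series \<open>V = 1 / (1 - T)\<close>, where \<open>T = x F\<^sub>0\<close> is the tree function.\<close>

definition tree_inverse :: "real fps" where
  "tree_inverse = inverse (1 - fps_X * parking_egf)"

lemma tree_inverse_mult: "tree_inverse * (1 - fps_X * parking_egf) = 1"
  unfolding tree_inverse_def by (rule inverse_mult_eq_1) simp

lemma tree_inverse_times_tree: "tree_inverse * (fps_X * parking_egf) = tree_inverse - 1"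
  using tree_inverse_mult by (simp add: algebra_simps)

lemma tree_inverse_neq_0: "tree_inverse \<noteq> 0"
  using tree_inverse_mult by auto

text \<open>The equation for \<open>F\<^sub>0\<close> reads \<open>(1 - T) \<theta> F\<^sub>0 = T F\<^sub>0\<close>, and \<open>V T = V - 1\<close>.\<close>

lemma theta_parking_egf: "fps_theta parking_egf = parking_egf * (tree_inverse - 1)"
proof -
  let ?F = parking_egf and ?V = tree_inverse
  have "2 * (fps_theta ?F * (1 - fps_X * ?F)) = 2 * (fps_X * ?F * ?F)"
    using area_moment_egf_equation_0 by (simp add: algebra_simps)
  then have "fps_theta ?F * (1 - fps_X * ?F) = fps_X * ?F * ?F" by simp
  then have "fps_theta ?F * (?V * (1 - fps_X * ?F)) = (?V * (fps_X * ?F)) * ?F" by (simp add: mult_ac)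
  then show ?thesis unfolding tree_inverse_mult tree_inverse_times_tree by (simp add: mult_ac)
qed

lemma theta_tree: "fps_theta (fps_X * parking_egf) = tree_inverse - 1"
  using tree_inverse_times_tree by (simp add: theta_parking_egf algebra_simps)

lemma theta_tree_inverse: "fps_theta tree_inverse = tree_inverse ^ 3 - tree_inverse ^ 2"
proof -
  let ?V = tree_inverse and ?T = "fps_X * parking_egf"
  have "fps_theta (?V * (1 - ?T)) = 0" unfolding tree_inverse_mult using fps_theta_const[of 1] by simp
  moreover have "fps_theta (1 - ?T) = - (?V - 1)"
    using fps_theta_const[of "1::real"] theta_tree by (simp only: fps_theta_diff) simp
  ultimately have "fps_theta ?V * (1 - ?T) + ?V * - (?V - 1) = 0" by (simp only: fps_theta_mult)
  then have "fps_theta ?V * (1 - ?T) = ?V * (?V - 1)" by algebra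
  then have "fps_theta ?V * (?V * (1 - ?T)) = ?V * (?V * (?V - 1))" by (simp add: mult_ac)
  then show ?thesis unfolding tree_inverse_mult by (simp add: power2_eq_square power3_eq_cube algebra_simps)
qed

text \<open>Evaluation at \<open>V\<close>. The argument has real coefficients, so that identities between the series
  \<open>F\<^sub>k\<close> reduce to numerical computations with coefficient lists.\<close>

definition at_tree :: "real poly \<Rightarrow> real fps" where
  "at_tree p = poly (map_poly fps_const p) tree_inverse"

lemma at_tree_0 [simp]: "at_tree 0 = 0" by (simp add: at_tree_def)

lemma at_tree_pCons: "at_tree (pCons c p) = fps_const c + tree_inverse * at_tree p"
  by (simp add: at_tree_def map_poly_pCons)

lemma at_tree_add [simp]: "at_tree (p + q) = at_tree p + at_tree q"
  by (induction p q rule: poly_induct2) (simp_all add: at_tree_pCons algebra_simps flip: fps_const_add)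

lemma at_tree_smult [simp]: "at_tree (smult c p) = fps_const c * at_tree p"
  by (induction p) (simp_all add: at_tree_pCons algebra_simps flip: fps_const_mult)

lemma at_tree_diff [simp]: "at_tree (p - q) = at_tree p - at_tree q"
  using at_tree_add[of p "smult (-1) q"] at_tree_smult[of "-1" q] by (simp flip: fps_const_neg)

lemma at_tree_mult [simp]: "at_tree (p * q) = at_tree p * at_tree q"
  by (induction p) (simp_all add: at_tree_pCons algebra_simps)

lemma at_tree_sum [simp]: "at_tree (sum f A) = (\<Sum>x\<in>A. at_tree (f x))"
  by (induction A rule: infinite_finite_induct) simp_all

lemma theta_at_tree: "fps_theta (at_tree p) = (tree_inverse ^ 3 - tree_inverse ^ 2) * at_tree (pderiv p)"
proof (induction p)
  case (pCons c p)
  have "fps_theta (at_tree (pCons c p)) = fps_theta tree_inverse * at_tree p + tree_inverse * fps_theta (at_tree p)"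
    by (simp add: at_tree_pCons)
  also have "\<dots> = (tree_inverse ^ 3 - tree_inverse ^ 2) * at_tree (pderiv (pCons c p))"
    unfolding pCons.IH theta_tree_inverse by (simp add: pderiv_pCons at_tree_pCons algebra_simps)
  finally show ?case .
qed simp

text \<open>The operator \<open>L\<close> with \<open>\<theta> (F\<^sub>0 p(V)) = F\<^sub>0 (L p)(V)\<close>.\<close>

definition theta_poly :: "real poly \<Rightarrow> real poly" where
  "theta_poly p = [:-1, 1:] * p + [:0, 0, -1, 1:] * pderiv p"

text \<open>A Horner scheme for \<open>L\<close>, from \<open>L (v p) = v L p + (v\<^sup>3 - v\<^sup>2) p\<close>. It evaluates \<open>L\<close> on explicit
  coefficient lists without unfolding a product.\<close>

lemma theta_poly_simps:
  "theta_poly 0 = 0"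
  "theta_poly (pCons a p) = [:- a, a:] + pCons 0 (theta_poly p + pCons 0 (pCons 0 p - p))"
  by (simp_all add: theta_poly_def pderiv_pCons algebra_simps)

lemma theta_parking_egf_at_tree:
  "fps_theta (parking_egf * at_tree p) = parking_egf * at_tree (theta_poly p)"
proof -
  have *: "at_tree [:-1, 1:] = tree_inverse - 1" "at_tree [:0, 0, -1, 1:] = tree_inverse ^ 3 - tree_inverse ^ 2"
    by (simp_all add: at_tree_pCons algebra_simps power2_eq_square power3_eq_cube flip: fps_const_neg)
  then show ?thesis
    unfolding theta_poly_def at_tree_add at_tree_mult *
    by (simp add: theta_parking_egf theta_at_tree algebra_simps)
qed

text \<open>With \<open>F\<^sub>i = F\<^sub>0 p\<^sub>i(V)\<close> for \<open>i \<le> k\<close>, the candidate \<open>F\<^sub>0 p(V)\<close> for \<open>F\<^sub>k\<^sub>+\<^sub>1\<close> satisfies the same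
  differential equation as \<open>F\<^sub>k\<^sub>+\<^sub>1\<close> as soon as \<open>p\<close> satisfies a polynomial identity. That identity is
  the differential equation, divided by \<open>F\<^sub>0\<close> and multiplied by \<open>V\<close> in order to replace \<open>V T\<close> by the
  polynomial \<open>V - 1\<close>. The candidate equals \<open>F\<^sub>k\<^sub>+\<^sub>1\<close> by uniqueness.\<close>

lemma area_moment_egf_step:
  fixes q :: "nat \<Rightarrow> real poly" and k :: nat
  defines "s \<equiv> \<Sum>i\<le>Suc k. q i * q (Suc k - i)"
  assumes q0: "q 0 = 1"
  assumes prev: "\<And>i. i \<le> k \<Longrightarrow> area_moment_egf i = parking_egf * at_tree (q i)"
  assumes eq: "[:0, 1:] * (smult 2 (theta_poly (q (Suc k))) + smult (real (2 * Suc k)) (q (Suc k))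
        - theta_poly (theta_poly (q k)) + theta_poly (q k) + smult (real (2 * k)) (q k))
      = [:-1, 1:] * (s + [:0, 1:] * s + theta_poly s)"
  shows "area_moment_egf (Suc k) = parking_egf * at_tree (q (Suc k))"
proof -
  let ?F = area_moment_egf and ?V = tree_inverse and ?\<theta> = fps_theta
  define C where "C = ?F 0 * at_tree (q (Suc k))"
  define R where "R = (\<Sum>i=1..k. ?F i * ?F (Suc k - i))"
  \<comment> \<open>The unknown series occurs in the two outer terms of the convolution.\<close>
  have split: "(\<Sum>i\<le>Suc k. g i) = g 0 + (\<Sum>i=1..k. g i) + g (Suc k)" for g :: "nat \<Rightarrow> real fps"
  proof -
    have "{..Suc k} = insert 0 (insert (Suc k) {1..k})" by auto
    then show ?thesis by (simp add: add_ac)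
  qed
  have S: "(\<Sum>i\<le>Suc k. ?F i * ?F (Suc k - i)) = R + 2 * (?F 0 * ?F (Suc k))"
    unfolding split R_def by (simp add: algebra_simps)
  have R: "R + 2 * (?F 0 * C) = ?F 0 * (?F 0 * at_tree s)"
  proof -
    have "R = (\<Sum>i=1..k. ?F 0 * (?F 0 * at_tree (q i * q (Suc k - i))))"
      unfolding R_def
    proof (rule sum.cong[OF refl])
      fix i assume "i \<in> {1..k}"
      then have "?F i = ?F 0 * at_tree (q i)" "?F (Suc k - i) = ?F 0 * at_tree (q (Suc k - i))"
        by (auto intro!: prev)
      then show "?F i * ?F (Suc k - i) = ?F 0 * (?F 0 * at_tree (q i * q (Suc k - i)))"
        by (simp only: at_tree_mult mult_ac)
    qed
    moreover have "at_tree s = at_tree (q 0 * q (Suc k)) + (\<Sum>i=1..k. at_tree (q i * q (Suc k - i))) + at_tree (q (Suc k) * q 0)"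
      unfolding s_def at_tree_sum split by simp
    moreover have "at_tree (q 0) = 1" unfolding q0 one_pCons at_tree_pCons by simp
    ultimately show ?thesis by (simp add: C_def sum_distrib_left algebra_simps)
  qed
  have XR: "fps_X * (R + 2 * (?F 0 * C)) = ?F 0 * (fps_X * ?F 0 * at_tree s)"
    unfolding R by (simp add: mult_ac)
  have V1: "at_tree [:0, 1:] = ?V" "at_tree [:-1, 1:] = ?V - 1"
    by (simp_all add: at_tree_pCons flip: fps_const_neg)
  have "2 * ?\<theta> C + of_nat (2 * Suc k) * C - ?\<theta> (?\<theta> (?F k)) + ?\<theta> (?F k) + of_nat (2 * k) * ?F k
      = ?\<theta> (fps_X * (R + 2 * (?F 0 * C))) + fps_X * (R + 2 * (?F 0 * C))"
  proof -
    let ?P = "smult 2 (theta_poly (q (Suc k))) + smult (real (2 * Suc k)) (q (Suc k))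
        - theta_poly (theta_poly (q k)) + theta_poly (q k) + smult (real (2 * k)) (q k)"
    have L: "2 * ?\<theta> C + of_nat (2 * Suc k) * C - ?\<theta> (?\<theta> (?F k)) + ?\<theta> (?F k) + of_nat (2 * k) * ?F k
       = ?F 0 * at_tree ?P"
      unfolding C_def prev[OF order_refl] theta_parking_egf_at_tree at_tree_add at_tree_diff at_tree_smult
        fps_of_nat[symmetric] fps_numeral_fps_const
      by (simp only: ring_distribs mult_ac)
    have X: "?\<theta> (?F 0 * (fps_X * ?F 0 * at_tree s)) = (?V - 1) * (?F 0 * at_tree s) + fps_X * ?F 0 * (?F 0 * at_tree (theta_poly s))"
    proof -
      have "?F 0 * (fps_X * ?F 0 * at_tree s) = (fps_X * ?F 0) * (?F 0 * at_tree s)" by (simp add: mult_ac)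
      then show ?thesis by (simp only: fps_theta_mult[of "fps_X * ?F 0"] theta_tree theta_parking_egf_at_tree)
    qed
    have "?V * (?\<theta> (?F 0 * (fps_X * ?F 0 * at_tree s)) + ?F 0 * (fps_X * ?F 0 * at_tree s))
      = ?F 0 * (?V * ((?V - 1) * at_tree s) + (?V * (fps_X * ?F 0)) * (at_tree (theta_poly s) + at_tree s))"
      unfolding X by (simp add: algebra_simps)
    also have "\<dots> = ?F 0 * at_tree ([:-1, 1:] * (s + [:0, 1:] * s + theta_poly s))"
      unfolding tree_inverse_times_tree at_tree_mult at_tree_add V1 by (simp add: algebra_simps)
    also have "\<dots> = ?V * (?F 0 * at_tree ?P)"
      unfolding eq[symmetric] at_tree_mult V1 by (simp only: mult_ac)
    finally have "?V * (?F 0 * at_tree ?P) = ?V * (?\<theta> (?F 0 * (fps_X * ?F 0 * at_tree s)) + ?F 0 * (fps_X * ?F 0 * at_tree s))"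
      by (rule sym)
    then have "?F 0 * at_tree ?P = ?\<theta> (?F 0 * (fps_X * ?F 0 * at_tree s)) + ?F 0 * (fps_X * ?F 0 * at_tree s)"
      using tree_inverse_neq_0 by (simp only: mult_cancel_left) simp
    then show ?thesis unfolding L XR by simp
  qed
  note eqC = this
  have eqF: "2 * ?\<theta> (?F (Suc k)) + of_nat (2 * Suc k) * ?F (Suc k) - ?\<theta> (?\<theta> (?F k)) + ?\<theta> (?F k) + of_nat (2 * k) * ?F k
      = ?\<theta> (fps_X * (R + 2 * (?F 0 * ?F (Suc k)))) + fps_X * (R + 2 * (?F 0 * ?F (Suc k)))"
    using area_moment_egf_equation[of k] unfolding S by simp
  have dist: "fps_X * (R + 2 * (?F 0 * Y)) = fps_X * R + (fps_X * (?F 0 * Y) + fps_X * (?F 0 * Y))" for Y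
    by (simp add: algebra_simps)
  \<comment> \<open>The two equations differ only in the terms that contain the unknown series.\<close>
  have cancel: "a2 - a1 = (y2 + z2) - (y1 + z1)"
    if "a1 - b + c + e = (r1 + y1) + (r2 + z1)" "a2 - b + c + e = (r1 + y2) + (r2 + z2)"
    for a1 a2 b c e r1 r2 y1 y2 z1 z2 :: "real fps"
    using that by algebra
  define D where "D = ?F (Suc k) - C"
  have "(2 * ?\<theta> (?F (Suc k)) + of_nat (2 * Suc k) * ?F (Suc k)) - (2 * ?\<theta> C + of_nat (2 * Suc k) * C)
     = (?\<theta> (fps_X * (?F 0 * ?F (Suc k)) + fps_X * (?F 0 * ?F (Suc k))) + (fps_X * (?F 0 * ?F (Suc k)) + fps_X * (?F 0 * ?F (Suc k))))
     - (?\<theta> (fps_X * (?F 0 * C) + fps_X * (?F 0 * C)) + (fps_X * (?F 0 * C) + fps_X * (?F 0 * C)))"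
    by (rule cancel[OF eqC[unfolded dist fps_theta_add[of "fps_X * R"]] eqF[unfolded dist fps_theta_add[of "fps_X * R"]]])
  then have "2 * ?\<theta> D + of_nat (2 * Suc k) * D
      = ?\<theta> (fps_X * (?F 0 * D)) + fps_X * (?F 0 * D) + (?\<theta> (fps_X * (?F 0 * D)) + fps_X * (?F 0 * D))"
    unfolding D_def by (simp only: fps_theta_add fps_theta_diff right_diff_distrib) (simp only: algebra_simps)
  then have "D = 0" by (rule theta_equation_unique)
  then show ?thesis by (simp add: D_def C_def)
qed

text \<open>The polynomials \<open>p\<^sub>0, \<dots>, p\<^sub>6\<close>. For \<open>j = k + 1\<close>, the terms of the identity in \<open>area_moment_egf_step\<close>
  that contain \<open>p\<^sub>j\<close> add up to \<open>2 (v\<^sup>2 (v - 1) p\<^sub>j' + v (j + 1 - v) p\<^sub>j)\<close>, and comparing coefficients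
  determines \<open>p\<^sub>j\<close> from its predecessors. The degree of \<open>p\<^sub>j\<close> for \<open>j > 0\<close> is \<open>3 j - 1\<close>.\<close>

definition area_moment_poly :: "nat \<Rightarrow> real poly" where
  "area_moment_poly k =
     [[:1:],
      [:1 / 2, -1, 1 / 2:],
      [:- (1 / 12), - (1 / 24), 0, 13 / 12, - (19 / 12), 5 / 8:],
      [:1 / 24, 1 / 48, 0, - (23 / 48), 7 / 4, - (87 / 16), 9, - (325 / 48), 15 / 8:],
      [:- (19 / 720), - (13 / 960), 0, 115 / 384, - (67 / 48), 719 / 120, - (1521 / 80), 8929 / 192, - (233 / 3), 44471 / 576, - (1945 / 48), 1105 / 128:],
      [:3 / 160, 19 / 1920, 0, - (827 / 3840), 6577 / 5760, - (21977 / 3840), 16741 / 720, - (92893 / 1152), 220763 / 960, - (1506071 / 2880), 255437 / 288, - (263105 / 256), 861685 / 1152, - (234245 / 768), 1695 / 32:],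
      [:- (863 / 60480), - (5611 / 725760), 0, 361 / 2160, - (199879 / 207360), 735343 / 138240, - (28639 / 1152), 10019617 / 96768, - (61001153 / 161280), 165837761 / 138240, - (10454209 / 3240), 82217167 / 11520, - (171249163 / 13824), 1318492087 / 82944, - (49027387 / 3456), 4204005 / 512, - (4227755 / 1536), 414125 / 1024:]] ! k"

lemma area_moment_egf_poly:
  assumes "k \<le> 6"
  shows "area_moment_egf k = parking_egf * at_tree (area_moment_poly k)"
  using assms
proof (induction k rule: less_induct)
  case (less k)
  show ?case
  proof (cases k)
    case 0
    then show ?thesis by (simp add: area_moment_poly_def at_tree_pCons)
  next
    case (Suc j)
    have q0: "area_moment_poly 0 = 1" by (simp add: area_moment_poly_def one_pCons)
    have "j \<in> {0, 1, 2, 3, 4, 5}" using Suc less.prems by auto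
    then have "[:0, 1:] * (smult 2 (theta_poly (area_moment_poly (Suc j))) + smult (real (2 * Suc j)) (area_moment_poly (Suc j))
        - theta_poly (theta_poly (area_moment_poly j)) + theta_poly (area_moment_poly j) + smult (real (2 * j)) (area_moment_poly j))
      = [:-1, 1:] * ((\<Sum>i\<le>Suc j. area_moment_poly i * area_moment_poly (Suc j - i))
         + [:0, 1:] * (\<Sum>i\<le>Suc j. area_moment_poly i * area_moment_poly (Suc j - i))
         + theta_poly (\<Sum>i\<le>Suc j. area_moment_poly i * area_moment_poly (Suc j - i)))"
      unfolding insert_iff empty_iff
      by (elim disjE FalseE) (simp_all add: area_moment_poly_def theta_poly_simps numeral_eq_Suc)
    then show ?thesis unfolding Suc
      by (intro area_moment_egf_step q0 less.IH) (use Suc less.prems in auto)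
  qed
qed

section \<open>Factorial moments and the growth of the mean\<close>

lemma coeff_one_plus_power: "coeff ([:1, 1:] ^ a) k = (of_nat (a choose k) :: real)"
proof (cases "k \<le> a")
  case True
  then show ?thesis by (simp add: coeff_linear_poly_power)
next
  case False
  have "degree ([:1, 1 :: real:] ^ a) \<le> a" using degree_power_le[of "[:1, 1 :: real:]" a] by simp
  then show ?thesis using False by (simp add: coeff_eq_0 binomial_eq_0)
qed

lemma area_moment_egf_nth:
  "area_moment_egf k $ n = (\<Sum>p\<in>parking_functions n. of_nat (nat_area p choose k)) / fact n"
  by (simp add: area_moment_egf_def area_egf_coeff_def area_poly_def coeff_sum coeff_one_plus_power)

lemma parking_egf_nth: "parking_egf $ n = card (parking_functions n) / fact n"
  by (simp add: area_moment_egf_nth)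

lemma parking_egf_nth_neq_0: "parking_egf $ n \<noteq> 0"
  by (simp add: parking_egf_nth finite_parking_functions parking_functions_nonempty)

lemma parking_expectation:
  "measure_pmf.expectation (parking_pmf n) f = (\<Sum>p\<in>parking_functions n. f p) / card (parking_functions n)"
  unfolding parking_pmf_def
  by (rule integral_pmf_of_set) (simp_all add: finite_parking_functions parking_functions_nonempty)

lemma falling_factorial_eq_choose: "(\<Prod>i<k. real a - real i) = fact k * real (a choose k)"
  by (simp add: binomial_gbinomial gbinomial_prod_rev atLeast0LessThan)

text \<open>The factorials of \<open>n\<close> cancel in the quotient, since \<open>F\<^sub>0\<close> counts parking functions.\<close>

lemma factorial_moment_area:
  "factorial_moment (parking_pmf n) area k = fact k * area_moment_egf k $ n / parking_egf $ n"
proof -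
  have "factorial_moment (parking_pmf n) area k
      = (\<Sum>p\<in>parking_functions n. \<Prod>i<k. area p - real i) / card (parking_functions n)"
    by (simp only: factorial_moment_def parking_expectation)
  also have "(\<Sum>p\<in>parking_functions n. \<Prod>i<k. area p - real i)
      = (\<Sum>p\<in>parking_functions n. fact k * real (nat_area p choose k))"
    by (intro sum.cong refl) (simp only: area_eq_nat_area falling_factorial_eq_choose)
  finally show ?thesis
    by (simp add: area_moment_egf_nth parking_egf_nth sum_distrib_left)
qed

lemma E1_eq_factorial_moment: "E1 n = factorial_moment (parking_pmf n) area 1"
  by (simp add: E1_def factorial_moment_def)

text \<open>The polynomial \<open>a(L) p\<close>, where \<open>cs\<close> lists the coefficients of \<open>a\<close> with the constant term first.\<close>

definition theta_comb :: "real list \<Rightarrow> real poly \<Rightarrow> real poly" where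
  "theta_comb cs p = foldr (\<lambda>c r. smult c p + theta_poly r) cs 0"

lemma theta_comb_simps:
  "theta_comb [] p = 0"
  "theta_comb (c # cs) p = smult c p + theta_poly (theta_comb cs p)"
  by (simp_all add: theta_comb_def)

text \<open>The operator \<open>\<theta>\<close> multiplies the \<open>n\<close>-th coefficient by \<open>n\<close>, so \<open>a(\<theta>)\<close> multiplies it by \<open>a(n)\<close>.\<close>

lemma theta_comb_nth:
  "(parking_egf * at_tree (theta_comb cs p)) $ n = horner_sum (\<lambda>c. c) (real n) cs * (parking_egf * at_tree p) $ n"
proof (induction cs)
  case (Cons c cs)
  let ?r = "theta_comb cs p"
  have "parking_egf * at_tree (theta_comb (c # cs) p) = fps_const c * (parking_egf * at_tree p) + fps_theta (parking_egf * at_tree ?r)"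
    unfolding theta_parking_egf_at_tree by (simp add: theta_comb_def algebra_simps)
  then have "(parking_egf * at_tree (theta_comb (c # cs) p)) $ n
      = c * (parking_egf * at_tree p) $ n + real n * (parking_egf * at_tree ?r) $ n"
    by (simp only: fps_add_nth fps_mult_left_const_nth fps_theta_nth)
  then show ?case unfolding Cons.IH by (simp add: algebra_simps)
qed (simp add: theta_comb_def)

lemma factorial_moment_area_formula:
  assumes "k \<le> 6"
    and "smult (fact k) (area_moment_poly k) = theta_comb as 1 + theta_comb bs (area_moment_poly 1)"
  shows "factorial_moment (parking_pmf n) area k
     = horner_sum (\<lambda>c. c) (real n) as + horner_sum (\<lambda>c. c) (real n) bs * E1 n"
proof -
  have "fps_const (fact k) * area_moment_egf k = parking_egf * at_tree (smult (fact k) (area_moment_poly k))"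
    using area_moment_egf_poly[OF assms(1)] by (simp add: mult_ac)
  also have "\<dots> = parking_egf * at_tree (theta_comb as 1) + parking_egf * at_tree (theta_comb bs (area_moment_poly 1))"
    unfolding assms(2) by (simp add: distrib_left)
  finally have "fact k * area_moment_egf k $ n
      = horner_sum (\<lambda>c. c) (real n) as * (parking_egf * at_tree 1) $ n
        + horner_sum (\<lambda>c. c) (real n) bs * (parking_egf * at_tree (area_moment_poly 1)) $ n"
    by (metis fps_add_nth fps_mult_left_const_nth theta_comb_nth)
  moreover have "at_tree 1 = 1" unfolding one_pCons at_tree_pCons by simp
  moreover have "parking_egf * at_tree (area_moment_poly 1) = area_moment_egf 1"
    using area_moment_egf_poly[of 1] by simp
  ultimately have "fact k * area_moment_egf k $ n
      = horner_sum (\<lambda>c. c) (real n) as * parking_egf $ n + horner_sum (\<lambda>c. c) (real n) bs * area_moment_egf 1 $ n"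
    by simp
  then show ?thesis
    unfolding E1_eq_factorial_moment factorial_moment_area
    using parking_egf_nth_neq_0[of n] by (simp add: field_simps)
qed

text \<open>The negative sign of \<open>E\<^sub>1\<close> is what makes the second moment bound \<open>E\<^sub>1\<close> itself.\<close>

lemma second_factorial_moment_area:
  "factorial_moment (parking_pmf n) area 2
     = 5 / 12 * real n ^ 3 - 1 / 12 * real n ^ 2 - 1 / 3 * real n - 7 / 3 * E1 n - 7 / 3 * (real n * E1 n)"
proof -
  have "factorial_moment (parking_pmf n) area 2 = horner_sum (\<lambda>c. c) (real n) [0, - (1 / 3), - (1 / 12), 5 / 12]
      + horner_sum (\<lambda>c. c) (real n) [- (7 / 3), - (7 / 3)] * E1 n"
    by (rule factorial_moment_area_formula)
       (simp_all add: theta_comb_simps theta_poly_simps area_moment_poly_def one_pCons fact_numeral)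
  then show ?thesis by (simp add: field_simps power2_eq_square power3_eq_cube)
qed

text \<open>Both \<open>720 p\<^sub>6\<close> and the two combinations have degree at most \<open>17\<close>; the \<open>18\<close> polynomials \<open>L\<^sup>j 1\<close>
  with \<open>j \<le> 9\<close> and \<open>L\<^sup>j p\<^sub>1\<close> with \<open>j \<le> 7\<close> span these degrees, which explains the shape of the formula.\<close>

lemma sixth_factorial_moment_area:
  "factorial_moment (parking_pmf n) area 6
     = horner_sum (\<lambda>c. c) (real n) [0, - (358936540409 / 1660538880), - (643359542029 / 1660538880), - (18783816473 / 332107776), 88215445651 / 332107776, 414139396709 / 1660538880, 14473244813 / 127733760, 9401544029 / 332107776, 373340075 / 110702592, 82825 / 576576]
     + horner_sum (\<lambda>c. c) (real n) [- (921390308389 / 830269440), - (864000570107 / 276756480), - (601794266581 / 166053888), - (149860633081 / 63866880), - (119912501 / 129024), - (259283273 / 1161216), - (186349 / 6144), - (3955 / 2048)] * E1 n"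
  by (rule factorial_moment_area_formula)
     (simp_all add: theta_comb_simps theta_poly_simps area_moment_poly_def one_pCons fact_numeral)

lemma E1_nonneg: "E1 n \<ge> 0"
  unfolding E1_def parking_expectation by (auto intro!: sum_nonneg divide_nonneg_nonneg simp: area_eq_nat_area)

text \<open>The right-hand side is the second moment, because \<open>A\<^sup>2 = A (A - 1) + A\<close>.\<close>

lemma E1_squared_le: "(E1 n)\<^sup>2 \<le> factorial_moment (parking_pmf n) area 2 + E1 n"
proof -
  let ?P = "parking_functions n"
  have card: "card ?P > 0" by (simp add: card_gt_0_iff finite_parking_functions parking_functions_nonempty)
  have "factorial_moment (parking_pmf n) area 2 + E1 n = (\<Sum>p\<in>?P. (area p)\<^sup>2) / card ?P"
    unfolding E1_def factorial_moment_def parking_expectation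
    by (simp add: numeral_2_eq_2 power2_eq_square right_diff_distrib sum_subtractf flip: add_divide_distrib)
  moreover have "(E1 n)\<^sup>2 = (\<Sum>p\<in>?P. area p)\<^sup>2 / (card ?P)\<^sup>2"
    by (simp add: E1_def parking_expectation power_divide)
  moreover have "(\<Sum>p\<in>?P. area p)\<^sup>2 / (card ?P)\<^sup>2 \<le> ((\<Sum>p\<in>?P. (area p)\<^sup>2) * card ?P) / (card ?P)\<^sup>2"
    by (intro divide_right_mono sum_squared_le_sum_of_squares) simp
  ultimately show ?thesis using card by (simp add: power2_eq_square)
qed

lemma E1_le: "E1 n \<le> real n powr (3 / 2)"
proof -
  have "(E1 n)\<^sup>2 \<le> real n ^ 3"
  proof -
    \<comment> \<open>The mean enters the second moment with total coefficient \<open>- 7/3 n - 4/3\<close>, so dropping it gives an upper bound.\<close>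
    have "0 \<le> real n * E1 n" using E1_nonneg[of n] by simp
    moreover have "0 \<le> real n ^ 2" "0 \<le> real n ^ 3" by simp_all
    ultimately show ?thesis
      using E1_squared_le[of n] E1_nonneg[of n] unfolding second_factorial_moment_area
      by linarith
  qed
  also have "real n ^ 3 = (real n powr (3 / 2))\<^sup>2"
    by (cases "n = 0") (simp_all add: powr_powr flip: powr_numeral)
  finally show ?thesis by (rule power2_le_imp_le) simp
qed

lemma E1_bigo: "E1 \<in> O(\<lambda>n. real n powr (3 / 2))"
  by (rule bigoI[of _ 1]) (use E1_le E1_nonneg in auto)

theorem theorem2p12:
  shows "(\<forall>n\<ge>1. factorial_moment (parking_pmf n) area 6 =
            82825 / 576576 * real n ^ 9
            + 373340075 / 110702592 * real n ^ 8
            + 9401544029 / 332107776 * real n ^ 7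
            + 14473244813 / 127733760 * real n ^ 6
            + 414139396709 / 1660538880 * real n ^ 5
            + 88215445651 / 332107776 * real n ^ 4
            - 18783816473 / 332107776 * real n ^ 3
            - 643359542029 / 1660538880 * real n ^ 2
            - 358936540409 / 1660538880 * real n
            + (- (3955 / 2048) * real n ^ 7
              - 186349 / 6144 * real n ^ 6
              - 259283273 / 1161216 * real n ^ 5
              - 119912501 / 129024 * real n ^ 4
              - 149860633081 / 63866880 * real n ^ 3
              - 601794266581 / 166053888 * real n ^ 2
              - 864000570107 / 276756480 * real n
              - 921390308389 / 830269440) * E1 n)
       \<and> (\<lambda>n. factorial_moment (parking_pmf n) area 6 - 82825 / 576576 * real n ^ 9)
             \<in> O(\<lambda>n. real n powr (17 / 2))"
proof (intro conjI allI impI)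
  fix n :: nat
  show "factorial_moment (parking_pmf n) area 6 =
            82825 / 576576 * real n ^ 9
            + 373340075 / 110702592 * real n ^ 8
            + 9401544029 / 332107776 * real n ^ 7
            + 14473244813 / 127733760 * real n ^ 6
            + 414139396709 / 1660538880 * real n ^ 5
            + 88215445651 / 332107776 * real n ^ 4
            - 18783816473 / 332107776 * real n ^ 3
            - 643359542029 / 1660538880 * real n ^ 2
            - 358936540409 / 1660538880 * real n
            + (- (3955 / 2048) * real n ^ 7
              - 186349 / 6144 * real n ^ 6
              - 259283273 / 1161216 * real n ^ 5
              - 119912501 / 129024 * real n ^ 4
              - 149860633081 / 63866880 * real n ^ 3
              - 601794266581 / 166053888 * real n ^ 2
              - 864000570107 / 276756480 * real n
              - 921390308389 / 830269440) * E1 n"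
    unfolding sixth_factorial_moment_area by (simp add: algebra_simps eval_nat_numeral)
next
  \<comment> \<open>The coefficient list of the first polynomial without its entry for \<open>n\<^sup>9\<close>.\<close>
  let ?a = "\<lambda>n. horner_sum (\<lambda>c. c) (real n) [0, - (358936540409 / 1660538880), - (643359542029 / 1660538880), - (18783816473 / 332107776), 88215445651 / 332107776, 414139396709 / 1660538880, 14473244813 / 127733760, 9401544029 / 332107776, 373340075 / 110702592]"
  let ?b = "\<lambda>n. horner_sum (\<lambda>c. c) (real n) [- (921390308389 / 830269440), - (864000570107 / 276756480), - (601794266581 / 166053888), - (149860633081 / 63866880), - (119912501 / 129024), - (259283273 / 1161216), - (186349 / 6144), - (3955 / 2048)]"
  have "factorial_moment (parking_pmf n) area 6 - 82825 / 576576 * real n ^ 9 = ?a n + ?b n * E1 n" for n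
    unfolding sixth_factorial_moment_area by (simp add: algebra_simps eval_nat_numeral)
  moreover have "(\<lambda>n. ?a n + ?b n * E1 n) \<in> O(\<lambda>n. real n powr (17 / 2))"
  proof (rule sum_in_bigo)
    show "?a \<in> O(\<lambda>n. real n powr (17 / 2))" unfolding horner_sum_simps by real_asymp
    have "?b \<in> O(\<lambda>n. real n ^ 7)" unfolding horner_sum_simps by real_asymp
    then have "(\<lambda>n. ?b n * E1 n) \<in> O(\<lambda>n. real n ^ 7 * real n powr (3 / 2))"
      by (rule landau_o.big.mult) (rule E1_bigo)
    also have "(\<lambda>n. real n ^ 7 * real n powr (3 / 2)) \<in> O(\<lambda>n. real n powr (17 / 2))" by real_asymp
    finally show "(\<lambda>n. ?b n * E1 n) \<in> O(\<lambda>n. real n powr (17 / 2))" .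
  qed
  ultimately show "(\<lambda>n. factorial_moment (parking_pmf n) area 6 - 82825 / 576576 * real n ^ 9)
             \<in> O(\<lambda>n. real n powr (17 / 2))" by simp
qed

end
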